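(* Let $p,n\ge1$. For every $t\ge0$ let $0<m_t\le L_t$, $\sigma_t\ge0$, let $f_t=\frac1n\sum_{i=1}^nf_t^{(i)}$ with differentiable $f_t^{(i)}:\mathbb R^p\to\mathbb R$, where $f_t$ is $m_t$-strongly convex with global minimizer $x_t^*$, and assume $\|x_{t+1}^*-x_t^*\|\le\sigma_t$. Assume that one of the following holds for all $i$ and $t$, and define $\tilde X_t\in\mathbb R^{2\times2}$ and $\bar\alpha_t$ accordingly: (a) $f_t^{(i)}$ is $L_t$-smooth: $\tilde X_t=\begin{bmatrix}2L_t^2&0\\0&-1\end{bmatrix}$, $\bar\alpha_t=\frac{m_t}{L_t^2}$; (b) $f_t^{(i)}$ is $L_t$-smooth and convex: $\tilde X_t=\begin{bmatrix}0&L_t\\L_t&-1\end{bmatrix}$, $\bar\alpha_t=\frac1{L_t}$; (c) $f_t^{(i)}$ is $L_t$-smooth and $m_t$-strongly convex: $\tilde X_t=\begin{bmatrix}-2L_tm_t&L_t+m_t\\L_t+m_t&-1\end{bmatrix}$, $\bar\alpha_t=\frac1{L_t+m_t}$. Consider the stochastic online gradient iteration $x_{t+1}=x_t-\alpha_t\nabla f_t^{(i_t)}(x_t)$ with deterministic $x_0$, where the indices $i_t$ are sampled IID uniformly from $\{1,\ldots,n\}$, and suppose $\alpha_t\in[0,\bar\alpha_t]$ for all $t$. Let $G_t\ge0$ be defined by $G_t^2=\frac1n\sum_{i=1}^n\|\nabla f_t^{(i)}(x_t^* )\|^2$. Let $\mathcal T_t\subseteq\mathbb R_+^4$ be the set of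 tuples of non-negative scalars $(\rho_t,\lambda_t^{(1)},\lambda_t^{(2)},\lambda_t^{(3)})$ satisfying $$\begin{bmatrix}1-\rho_t^2&-\alpha_t&1\\-\alpha_t&\alpha_t^2&-\alpha_t\\1&-\alpha_t&1-\lambda_t^{(2)}\end{bmatrix}+\lambda_t^{(1)}\begin{bmatrix}-2m_t&1&0\\1&0&0\\0&0&0\end{bmatrix}+\lambda_t^{(3)}\begin{bmatrix}\tilde X_t&0_{2\times1}\\0_{1\times2}&0\end{bmatrix}\preceq0.$$ Let $\hat U_0=\|x_0-x_0^*\|^2$ and, for $t\ge0$, $$\hat U_{t+1}=\inf_{(\rho_t,\lambda_t^{(1)},\lambda_t^{(2)},\lambda_t^{(3)})\in\mathcal T_t}\left(\rho_t^2\hat U_t+\lambda_t^{(2)}\sigma_t^2+2\lambda_t^{(3)}G_t^2\right).$$ Then for all $t\ge0$, $$\hat U_{t+1}=\left(\sqrt{\hat\rho_t\hat U_t+2\alpha_t^2G_t^2}+\sigma_t\right)^2,$$ where $\hat\rho_t=1-2\alpha_tm_t+\tilde m_t\alpha_t^2$ and $\tilde m_t:=\tilde X_t(1,1)+2m_t\tilde X_t(2,1)$.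
   Context: A differentiable $f$ is $L$-smooth if $\|\nabla f(x)-\nabla f(y)\|\le L\|x-y\|$ for all $x,y$, and $m$-strongly convex if $f(x)\ge f(y)+\nabla f(y)^T(x-y)+\frac m2\|x-y\|^2$ for all $x,y$. $\tilde X_t(i,j)$ denotes the $(i,j)$ entry of $\tilde X_t$. $P\preceq0$ means the symmetric matrix $P$ is negative semidefinite; norms are Euclidean. *)

theory Defs
  imports "HOL-Probability.Probability"
begin

text \<open>The value is meaningful only at points of differentiability, where \<open>D\<close> exists and is unique.\<close>

definition gradient :: "('a::real_inner \<Rightarrow> real) \<Rightarrow> 'a \<Rightarrow> 'a"
  where "gradient f x = (THE D. GDERIV f x :> D)"

definition smooth_fun :: "real \<Rightarrow> ('a::real_inner \<Rightarrow> real) \<Rightarrow> bool"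
  where "smooth_fun L f \<longleftrightarrow>
    (\<forall>x. f differentiable (at x)) \<and>
    (\<forall>x y. norm (gradient f x - gradient f y) \<le> L * norm (x - y))"

definition strongly_convex :: "real \<Rightarrow> ('a::real_inner \<Rightarrow> real) \<Rightarrow> bool"
  where "strongly_convex m f \<longleftrightarrow>
    (\<forall>x. f differentiable (at x)) \<and>
    (\<forall>x y. f x \<ge> f y + gradient f y \<bullet> (x - y) + m / 2 * (norm (x - y))\<^sup>2)"

definition neg_semidef :: "real ^ 'k ^ 'k \<Rightarrow> bool"
  where "neg_semidef A \<longleftrightarrow> transpose A = A \<and> (\<forall>v. v \<bullet> (A *v v) \<le> 0)"

datatype loss_class = Smooth | Smooth_Convex | Smooth_Strongly_Convex

fun in_class :: "loss_class \<Rightarrow> real \<Rightarrow> real \<Rightarrow> ('a::real_inner \<Rightarrow> real) \<Rightarrow> bool" where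
  "in_class Smooth m L f \<longleftrightarrow> smooth_fun L f"
| "in_class Smooth_Convex m L f \<longleftrightarrow> smooth_fun L f \<and> convex_on UNIV f"
| "in_class Smooth_Strongly_Convex m L f \<longleftrightarrow> smooth_fun L f \<and> strongly_convex m f"

fun X_tilde :: "loss_class \<Rightarrow> real \<Rightarrow> real \<Rightarrow> real ^ 2 ^ 2" where
  "X_tilde Smooth m L = vector [vector [2 * L\<^sup>2, 0], vector [0, -1]]"
| "X_tilde Smooth_Convex m L = vector [vector [0, L], vector [L, -1]]"
| "X_tilde Smooth_Strongly_Convex m L =
     vector [vector [-2 * L * m, L + m], vector [L + m, -1]]"

fun alpha_bar :: "loss_class \<Rightarrow> real \<Rightarrow> real \<Rightarrow> real" where
  "alpha_bar Smooth m L = m / L\<^sup>2"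
| "alpha_bar Smooth_Convex m L = 1 / L"
| "alpha_bar Smooth_Strongly_Convex m L = 1 / (L + m)"

definition pad_zero :: "real ^ 2 ^ 2 \<Rightarrow> real ^ 3 ^ 3"
  where "pad_zero X = vector
    [vector [X $ 1 $ 1, X $ 1 $ 2, 0],
     vector [X $ 2 $ 1, X $ 2 $ 2, 0],
     vector [0, 0, 0]]"

definition lmi_matrix ::
  "real \<Rightarrow> real \<Rightarrow> real ^ 2 ^ 2 \<Rightarrow> real \<Rightarrow> real \<Rightarrow> real \<Rightarrow> real \<Rightarrow> real ^ 3 ^ 3"
  where "lmi_matrix \<alpha> m X \<rho> l1 l2 l3 =
    vector
      [vector [1 - \<rho>\<^sup>2, - \<alpha>, 1],
       vector [- \<alpha>, \<alpha>\<^sup>2, - \<alpha>],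
       vector [1, - \<alpha>, 1 - l2]]
    + l1 *\<^sub>R vector
      [vector [-2 * m, 1, 0],
       vector [1, 0, 0],
       vector [0, 0, 0]]
    + l3 *\<^sub>R pad_zero X"

text \<open>For step sizes up to \<open>alpha_bar\<close> this set is non-empty: for every \<open>\<mu> > 0\<close> it contains the tuple with
  \<open>l2 = 1 + 1 / \<mu>\<close>, \<open>l3 = (1 + \<mu>) * \<alpha>\<^sup>2\<close>, \<open>l1 = (1 + \<mu>) * \<alpha> * (1 - \<alpha> * X $ 2 $ 1)\<close> and
  \<open>\<rho>\<^sup>2 = (1 + \<mu>) * rho_hat \<alpha> m X\<close>. Infima over it of non-negative functions are therefore
  genuine real infima.\<close>

definition feasible_set ::
  "real \<Rightarrow> real \<Rightarrow> real ^ 2 ^ 2 \<Rightarrow> (real \<times> real \<times> real \<times> real) set"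
  where "feasible_set \<alpha> m X =
    {(\<rho>, l1, l2, l3). 0 \<le> \<rho> \<and> 0 \<le> l1 \<and> 0 \<le> l2 \<and> 0 \<le> l3 \<and>
       neg_semidef (lmi_matrix \<alpha> m X \<rho> l1 l2 l3)}"

definition m_tilde :: "real \<Rightarrow> real ^ 2 ^ 2 \<Rightarrow> real"
  where "m_tilde m X = X $ 1 $ 1 + 2 * m * X $ 2 $ 1"

definition rho_hat :: "real \<Rightarrow> real \<Rightarrow> real ^ 2 ^ 2 \<Rightarrow> real"
  where "rho_hat \<alpha> m X = 1 - 2 * \<alpha> * m + m_tilde m X * \<alpha>\<^sup>2"

end

theory Submission
  imports Defs
begin

text \<open>
  The LMI says that the quadratic form
  \<open>(a - \<alpha> b + d)\<^sup>2 - \<rho>\<^sup>2 a\<^sup>2 - l2 d\<^sup>2 + l1 (2 a b - 2 m a\<^sup>2) + l3 (X11 a\<^sup>2 + 2 X21 a b - b\<^sup>2)\<close>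
  is non-positive. Write \<open>V = rho_hat U + 2 \<alpha>\<^sup>2 G\<^sup>2\<close>. For the lower bound on the infimum, average
  the form over a random triple with \<open>E a\<^sup>2 = U\<close>, \<open>E (a b) = m U\<close>, \<open>E b\<^sup>2 = m_tilde U + 2 G\<^sup>2\<close>
  (possible because \<open>m\<^sup>2 \<le> m_tilde\<close>) and \<open>d = s (a - \<alpha> b)\<close> with \<open>s = \<sigma> / sqrt V\<close>; then
  \<open>E (a - \<alpha> b)\<^sup>2 = V\<close> and \<open>E (a - \<alpha> b + d)\<^sup>2 = (sqrt V + \<sigma>)\<^sup>2\<close>. For the upper bound, Young's inequality
  \<open>(u + d)\<^sup>2 \<le> (1 + \<mu>) u\<^sup>2 + (1 + 1 / \<mu>) d\<^sup>2\<close> provides feasible tuples of cost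
  \<open>(1 + \<mu>) V + (1 + 1 / \<mu>) \<sigma>\<^sup>2\<close>, which come arbitrarily close to \<open>(sqrt V + \<sigma>)\<^sup>2\<close>.
\<close>

lemma X_tilde_entries:
  "X_tilde c m L $ 1 $ 2 = X_tilde c m L $ 2 $ 1" "X_tilde c m L $ 2 $ 2 = -1"
  by (cases c; simp)+

lemma lmi_matrix_quadratic_form:
  fixes v :: "real ^ 3"
  assumes "X $ 1 $ 2 = X $ 2 $ 1" "X $ 2 $ 2 = -1"
  shows "v \<bullet> (lmi_matrix \<alpha> m X \<rho> l1 l2 l3 *v v) =
    (v $ 1 - \<alpha> * v $ 2 + v $ 3)\<^sup>2 - \<rho>\<^sup>2 * (v $ 1)\<^sup>2 - l2 * (v $ 3)\<^sup>2
    + l1 * (2 * v $ 1 * v $ 2 - 2 * m * (v $ 1)\<^sup>2)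
    + l3 * (X $ 1 $ 1 * (v $ 1)\<^sup>2 + 2 * X $ 2 $ 1 * v $ 1 * v $ 2 - (v $ 2)\<^sup>2)"
  using assms
  by (simp add: lmi_matrix_def pad_zero_def inner_vec_def matrix_vector_mult_def sum_3
      power2_eq_square algebra_simps)

lemma neg_semidef_lmi_matrix_iff:
  assumes "X $ 1 $ 2 = X $ 2 $ 1" "X $ 2 $ 2 = -1"
  shows "neg_semidef (lmi_matrix \<alpha> m X \<rho> l1 l2 l3) \<longleftrightarrow>
    (\<forall>a b d. (a - \<alpha> * b + d)\<^sup>2 - \<rho>\<^sup>2 * a\<^sup>2 - l2 * d\<^sup>2 + l1 * (2 * a * b - 2 * m * a\<^sup>2)
      + l3 * (X $ 1 $ 1 * a\<^sup>2 + 2 * X $ 2 $ 1 * a * b - b\<^sup>2) \<le> 0)" (is "_ \<longleftrightarrow> (\<forall>a b d. ?q a b d \<le> 0)")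
proof -
  have "transpose (lmi_matrix \<alpha> m X \<rho> l1 l2 l3) = lmi_matrix \<alpha> m X \<rho> l1 l2 l3"
    using assms(1) by (simp add: lmi_matrix_def pad_zero_def transpose_def vec_eq_iff forall_3)
  moreover have "(\<forall>v. v \<bullet> (lmi_matrix \<alpha> m X \<rho> l1 l2 l3 *v v) \<le> 0) \<longleftrightarrow> (\<forall>a b d. ?q a b d \<le> 0)"
  proof -
    have "?q a b d = (vector [a, b, d] :: real ^ 3) \<bullet>
        (lmi_matrix \<alpha> m X \<rho> l1 l2 l3 *v vector [a, b, d])" for a b d
      by (simp add: lmi_matrix_quadratic_form[OF assms])
    then show ?thesis
      using lmi_matrix_quadratic_form[OF assms, of _ \<alpha> m \<rho> l1 l2 l3] by metis
  qed
  ultimately show ?thesis by (simp add: neg_semidef_def)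
qed

text \<open>\<open>m_tilde\<close> equals \<open>2 * L\<^sup>2\<close>, \<open>2 * m * L\<close> and
  \<open>2 * m\<^sup>2\<close> in the three classes. The bound makes
  \<open>m_tilde - m\<^sup>2\<close> usable as a variance of \<open>b\<close>.\<close>

lemma square_le_m_tilde:
  assumes "0 < m" "m \<le> L"
  shows "m\<^sup>2 \<le> m_tilde m (X_tilde c m L)"
proof (cases c)
  case Smooth
  moreover have "m\<^sup>2 \<le> L\<^sup>2" using assms by (auto intro: power_mono)
  then have "m\<^sup>2 \<le> 2 * L\<^sup>2" using zero_le_power2[of L] by linarith
  ultimately show ?thesis by (simp add: m_tilde_def)
next
  case Smooth_Convex
  moreover have "m * m \<le> m * L" "0 \<le> m * L" using assms by auto
  ultimately show ?thesis by (simp add: m_tilde_def power2_eq_square)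
next
  case Smooth_Strongly_Convex
  then show ?thesis by (simp add: m_tilde_def power2_eq_square algebra_simps)
qed

text \<open>This is how the step-size bound enters: it keeps the multiplier \<open>l1\<close> of the
  Young tuple non-negative.\<close>

lemma step_size_mult_X_tilde_le:
  assumes "0 < m" "m \<le> L" "\<alpha> \<in> {0..alpha_bar c m L}"
  shows "\<alpha> * X_tilde c m L $ 2 $ 1 \<le> 1"
  using assms by (cases c) (auto simp: field_simps)

lemma rho_hat_nonneg:
  assumes "m\<^sup>2 \<le> m_tilde m X"
  shows "0 \<le> rho_hat \<alpha> m X"
proof -
  have "0 \<le> (1 - \<alpha> * m)\<^sup>2 + (m_tilde m X - m\<^sup>2) * \<alpha>\<^sup>2"
    using assms by simp
  also have "\<dots> = rho_hat \<alpha> m X"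
    by (simp add: rho_hat_def power2_eq_square algebra_simps)
  finally show ?thesis .
qed

lemma young_square_add:
  fixes u d \<mu> :: real
  assumes "0 < \<mu>"
  shows "(u + d)\<^sup>2 \<le> (1 + \<mu>) * u\<^sup>2 + (1 + 1 / \<mu>) * d\<^sup>2"
proof -
  have "0 \<le> (\<mu> * u - d)\<^sup>2 / \<mu>" using assms by simp
  also have "\<dots> = (1 + \<mu>) * u\<^sup>2 + (1 + 1 / \<mu>) * d\<^sup>2 - (u + d)\<^sup>2"
    using assms by (simp add: field_simps power2_eq_square)
  finally show ?thesis by simp
qed

text \<open>After Young's inequality, \<open>(1 + \<mu>) * (a - \<alpha> * b)\<^sup>2\<close>
  remains to be absorbed. Comparing coefficients forces the tuple: \<open>l3\<close> cancels the
  square of \<open>b\<close>, then \<open>l1\<close> cancels the product \<open>a * b\<close>, and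
  \<rho> takes what is left at the square of \<open>a\<close>.\<close>

lemma young_tuple_feasible:
  assumes X: "X $ 1 $ 2 = X $ 2 $ 1" "X $ 2 $ 2 = -1"
    and "0 \<le> \<alpha>" "\<alpha> * X $ 2 $ 1 \<le> 1" "0 \<le> rho_hat \<alpha> m X" "0 < \<mu>"
  shows "(sqrt ((1 + \<mu>) * rho_hat \<alpha> m X), (1 + \<mu>) * \<alpha> * (1 - \<alpha> * X $ 2 $ 1),
      1 + 1 / \<mu>, (1 + \<mu>) * \<alpha>\<^sup>2) \<in> feasible_set \<alpha> m X"
proof -
  have "(a - \<alpha> * b + d)\<^sup>2 - (1 + \<mu>) * rho_hat \<alpha> m X * a\<^sup>2 - (1 + 1 / \<mu>) * d\<^sup>2
      + (1 + \<mu>) * \<alpha> * (1 - \<alpha> * X $ 2 $ 1) * (2 * a * b - 2 * m * a\<^sup>2)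
      + (1 + \<mu>) * \<alpha>\<^sup>2 * (X $ 1 $ 1 * a\<^sup>2 + 2 * X $ 2 $ 1 * a * b - b\<^sup>2) \<le> 0" for a b d
  proof -
    have "(a - \<alpha> * b)\<^sup>2 = rho_hat \<alpha> m X * a\<^sup>2
        - \<alpha> * (1 - \<alpha> * X $ 2 $ 1) * (2 * a * b - 2 * m * a\<^sup>2)
        - \<alpha>\<^sup>2 * (X $ 1 $ 1 * a\<^sup>2 + 2 * X $ 2 $ 1 * a * b - b\<^sup>2)"
      by (simp add: rho_hat_def m_tilde_def power2_eq_square algebra_simps)
    then show ?thesis
      using young_square_add[OF \<open>0 < \<mu>\<close>, of "a - \<alpha> * b" d]
      by (simp only: ring_distribs mult_ac)
  qed
  moreover have "0 \<le> (1 + \<mu>) * rho_hat \<alpha> m X" using assms by simp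
  ultimately show ?thesis
    using assms by (simp add: feasible_set_def neg_semidef_lmi_matrix_iff[OF X])
qed

lemma feasible_cost_ge:
  assumes X: "X $ 1 $ 2 = X $ 2 $ 1" "X $ 2 $ 2 = -1"
    and m: "m\<^sup>2 \<le> m_tilde m X" and "0 \<le> U" "0 \<le> \<sigma>"
    and feas: "(\<rho>, l1, l2, l3) \<in> feasible_set \<alpha> m X"
  shows "(sqrt (rho_hat \<alpha> m X * U + 2 * \<alpha>\<^sup>2 * G\<^sup>2) + \<sigma>)\<^sup>2
    \<le> \<rho>\<^sup>2 * U + l2 * \<sigma>\<^sup>2 + 2 * l3 * G\<^sup>2"
proof -
  define V where "V = rho_hat \<alpha> m X * U + 2 * \<alpha>\<^sup>2 * G\<^sup>2"
  have "0 \<le> V" using rho_hat_nonneg[OF m] \<open>0 \<le> U\<close> by (simp add: V_def)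
  have pos: "0 \<le> l2" "0 \<le> l3" using feas by (auto simp: feasible_set_def)
  have q: "(a - \<alpha> * b + d)\<^sup>2 - \<rho>\<^sup>2 * a\<^sup>2 - l2 * d\<^sup>2 + l1 * (2 * a * b - 2 * m * a\<^sup>2)
      + l3 * (X $ 1 $ 1 * a\<^sup>2 + 2 * X $ 2 $ 1 * a * b - b\<^sup>2) \<le> 0" for a b d
    using feas by (simp add: feasible_set_def neg_semidef_lmi_matrix_iff[OF X])
  show ?thesis
  proof (cases "V = 0")
    case True
    \<comment> \<open>The scaling \<open>s\<close> would divide by zero here, so the form is tested
      on \<open>d\<close> alone.\<close>
    have "\<sigma>\<^sup>2 \<le> l2 * \<sigma>\<^sup>2" using q[of 0 0 \<sigma>] by simp
    then have "\<sigma>\<^sup>2 \<le> \<rho>\<^sup>2 * U + l2 * \<sigma>\<^sup>2 + 2 * l3 * G\<^sup>2"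
      using pos \<open>0 \<le> U\<close> by (simp add: add_increasing add_increasing2)
    then show ?thesis using True by (simp add: V_def)
  next
    case False
    with \<open>0 \<le> V\<close> have "0 < V" by simp
    define s where "s = \<sigma> / sqrt V"
    define r where "r = sqrt U"
    \<comment> \<open>The random triple has constant \<open>a = r\<close> and
      \<open>b = m * r + w\<close> or \<open>b = m * r - w\<close> with equal probability;
      \<open>w\<close> is chosen to give \<open>b\<close> the required second moment.\<close>
    define w where "w = sqrt ((m_tilde m X - m\<^sup>2) * U + 2 * G\<^sup>2)"
    have r2: "r\<^sup>2 = U" using \<open>0 \<le> U\<close> by (simp add: r_def)
    have w2: "w\<^sup>2 = (m_tilde m X - m\<^sup>2) * U + 2 * G\<^sup>2" using m \<open>0 \<le> U\<close> by (simp add: w_def)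
    have s2: "s\<^sup>2 * V = \<sigma>\<^sup>2" using \<open>0 < V\<close> by (simp add: s_def power_divide)
    have "(1 + s) * sqrt V = sqrt V + \<sigma>" using \<open>0 < V\<close> by (simp add: s_def field_simps)
    then have target: "(sqrt V + \<sigma>)\<^sup>2 = (1 + s)\<^sup>2 * V"
      using \<open>0 \<le> V\<close> by (metis power_mult_distrib real_sqrt_pow2)
    have V_eq: "(1 - \<alpha> * m)\<^sup>2 * U + \<alpha>\<^sup>2 * w\<^sup>2 = V"
      unfolding V_def w2 rho_hat_def by (simp add: power2_eq_square algebra_simps)
    \<comment> \<open>The average of a quadratic form over the two signs is its value at the mean
      plus its value at the deviation. These are the two evaluations of \<open>q\<close> that
      follow; the \<open>l1\<close> term vanishes in both.\<close>
    have "(1 + s)\<^sup>2 * (1 - \<alpha> * m)\<^sup>2 * U - \<rho>\<^sup>2 * U - l2 * s\<^sup>2 * (1 - \<alpha> * m)\<^sup>2 * U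
        + l3 * (X $ 1 $ 1 + 2 * m * X $ 2 $ 1 - m\<^sup>2) * U \<le> 0"
      using q[of r "m * r" "s * (r - \<alpha> * (m * r))"] unfolding r2[symmetric]
      by (simp add: power2_eq_square algebra_simps)
    moreover have "(1 + s)\<^sup>2 * \<alpha>\<^sup>2 * w\<^sup>2 - l2 * s\<^sup>2 * \<alpha>\<^sup>2 * w\<^sup>2 - l3 * w\<^sup>2 \<le> 0"
      using q[of 0 w "- s * \<alpha> * w"] by (simp add: power2_eq_square algebra_simps)
    \<comment> \<open>In the sum, the factor of \<open>l3\<close> is \<open>- 2 * G\<^sup>2\<close>
      by the choice of \<open>w\<close>.\<close>
    ultimately have "(1 + s)\<^sup>2 * ((1 - \<alpha> * m)\<^sup>2 * U + \<alpha>\<^sup>2 * w\<^sup>2) - \<rho>\<^sup>2 * U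
        - l2 * (s\<^sup>2 * ((1 - \<alpha> * m)\<^sup>2 * U + \<alpha>\<^sup>2 * w\<^sup>2)) + l3 * ((m_tilde m X - m\<^sup>2) * U - w\<^sup>2) \<le> 0"
      by (simp add: m_tilde_def algebra_simps)
    then have "(1 + s)\<^sup>2 * V - \<rho>\<^sup>2 * U - l2 * \<sigma>\<^sup>2 - 2 * l3 * G\<^sup>2 \<le> 0"
      unfolding V_eq s2 by (simp add: w2)
    then show ?thesis
      using target by (simp add: V_def)
  qed
qed

text \<open>One time step of the recursion. Only the symmetry and the corner entry -1 of
  \<open>X\<close>, with the two inequalities above, are kept from the loss class, so all three
  classes are treated at once.\<close>

lemma INF_feasible_cost:
  assumes X: "X $ 1 $ 2 = X $ 2 $ 1" "X $ 2 $ 2 = -1"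
    and m: "m\<^sup>2 \<le> m_tilde m X" and \<alpha>: "0 \<le> \<alpha>" "\<alpha> * X $ 2 $ 1 \<le> 1"
    and U: "0 \<le> U" and \<sigma>: "0 \<le> \<sigma>"
  shows "(INF (\<rho>, l1, l2, l3) \<in> feasible_set \<alpha> m X. \<rho>\<^sup>2 * U + l2 * \<sigma>\<^sup>2 + 2 * l3 * G\<^sup>2)
    = (sqrt (rho_hat \<alpha> m X * U + 2 * \<alpha>\<^sup>2 * G\<^sup>2) + \<sigma>)\<^sup>2"
    (is "(INF z \<in> ?T. ?cost z) = (sqrt ?V + \<sigma>)\<^sup>2")
proof (rule antisym)
  note \<rho> = rho_hat_nonneg[OF m, of \<alpha>]
  have lower: "(sqrt ?V + \<sigma>)\<^sup>2 \<le> ?cost z" if "z \<in> ?T" for z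
    using feasible_cost_ge[OF X m U \<sigma>] that by (cases z) auto
  have "?T \<noteq> {}" using young_tuple_feasible[OF X \<alpha> \<rho>, of 1] by auto
  then show "(sqrt ?V + \<sigma>)\<^sup>2 \<le> (INF z \<in> ?T. ?cost z)"
    by (rule cINF_greatest) (rule lower)
  have "0 \<le> ?V" using \<rho> U by simp
  have upper: "(INF z \<in> ?T. ?cost z) \<le> (sqrt ?V + \<sigma> + 2 * \<delta>)\<^sup>2" if "0 < \<delta>" for \<delta>
  proof -
    \<comment> \<open>The minimizer \<open>\<sigma> / sqrt V\<close> of the cost over \<open>\<mu>\<close> degenerates when \<open>V = 0\<close> or \<open>\<sigma> = 0\<close>, hence the shifts by \<open>\<delta>\<close>.\<close>
    define \<mu> where "\<mu> = (\<sigma> + \<delta>) / (sqrt ?V + \<delta>)"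
    have p: "0 < sqrt ?V + \<delta>" "0 < \<sigma> + \<delta>"
      using \<open>0 \<le> ?V\<close> \<sigma> that by (auto intro: add_nonneg_pos)
    then have "0 < \<mu>" by (simp add: \<mu>_def)
    have "(INF z \<in> ?T. ?cost z) \<le> ?cost (sqrt ((1 + \<mu>) * rho_hat \<alpha> m X),
        (1 + \<mu>) * \<alpha> * (1 - \<alpha> * X $ 2 $ 1), 1 + 1 / \<mu>, (1 + \<mu>) * \<alpha>\<^sup>2)"
      by (rule cINF_lower[OF bdd_belowI2 young_tuple_feasible[OF X \<alpha> \<rho> \<open>0 < \<mu>\<close>]]) (rule lower)
    also have "\<dots> = (1 + \<mu>) * (sqrt ?V)\<^sup>2 + (1 + 1 / \<mu>) * \<sigma>\<^sup>2"
      using \<rho> \<open>0 < \<mu>\<close> \<open>0 \<le> ?V\<close> by (simp add: algebra_simps)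
    also have "\<dots> \<le> (1 + \<mu>) * (sqrt ?V + \<delta>)\<^sup>2 + (1 + 1 / \<mu>) * (\<sigma> + \<delta>)\<^sup>2"
      using \<open>0 < \<mu>\<close> \<open>0 < \<delta>\<close> \<open>0 \<le> ?V\<close> \<sigma>
      by (intro add_mono mult_left_mono power_mono) auto
    \<comment> \<open>Since \<mu> is exactly the ratio of the two shifted terms, Young's inequality
      holds with equality.\<close>
    also have "\<dots> = ((sqrt ?V + \<delta>) + (\<sigma> + \<delta>))\<^sup>2"
    proof -
      have "(1 + y / x) * x\<^sup>2 + (1 + 1 / (y / x)) * y\<^sup>2 = (x + y)\<^sup>2" if "0 < x" "0 < y" for x y :: real
        using that by (simp add: field_simps power2_eq_square)
      then show ?thesis using p unfolding \<mu>_def by blast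
    qed
    finally show ?thesis by (simp add: algebra_simps)
  qed
  have "((\<lambda>\<delta>. (sqrt ?V + \<sigma> + 2 * \<delta>)\<^sup>2) \<longlongrightarrow> (sqrt ?V + \<sigma> + 2 * 0)\<^sup>2) (at_right 0)"
    by (intro tendsto_intros)
  then have "(INF z \<in> ?T. ?cost z) \<le> (sqrt ?V + \<sigma> + 2 * 0)\<^sup>2"
    by (rule tendsto_lowerbound) (auto simp: eventually_at_right_less upper intro: eventually_mono[OF eventually_at_right_less])
  then show "(INF z \<in> ?T. ?cost z) \<le> (sqrt ?V + \<sigma>)\<^sup>2" by simp
qed

theorem theorem4p4:
  fixes n :: nat
    and c :: loss_class
    and m L \<sigma> \<alpha> G U :: "nat \<Rightarrow> real"
    and fi :: "nat \<Rightarrow> nat \<Rightarrow> real ^ 'p \<Rightarrow> real"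
    and f :: "nat \<Rightarrow> real ^ 'p \<Rightarrow> real"
    and xs :: "nat \<Rightarrow> real ^ 'p"
    and x0 :: "real ^ 'p"
    and M :: "'w measure"
    and idx :: "nat \<Rightarrow> 'w \<Rightarrow> nat"
    and x :: "nat \<Rightarrow> 'w \<Rightarrow> real ^ 'p"
  assumes "n \<ge> 1"
    and "\<And>t. 0 < m t" and "\<And>t. m t \<le> L t"
    and "\<And>t. \<sigma> t \<ge> 0"
    and "\<And>t i y. i \<in> {1..n} \<Longrightarrow> fi t i differentiable (at y)"
    and "\<And>t y. f t y = (1 / real n) * (\<Sum>i = 1..n. fi t i y)"
    and "\<And>t. strongly_convex (m t) (f t)"
    and "\<And>t y. f t (xs t) \<le> f t y"
    and "\<And>t. norm (xs (Suc t) - xs t) \<le> \<sigma> t"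
    and "\<And>t i. i \<in> {1..n} \<Longrightarrow> in_class c (m t) (L t) (fi t i)"
    and "prob_space M"
    and "prob_space.indep_vars M (\<lambda>_. count_space {1..n}) idx UNIV"
    and "\<And>t. distr M (count_space {1..n}) (idx t) = uniform_count_measure {1..n}"
    and "\<And>\<omega>. \<omega> \<in> space M \<Longrightarrow> x 0 \<omega> = x0"
    and "\<And>t \<omega>. \<omega> \<in> space M \<Longrightarrow>
           x (Suc t) \<omega> = x t \<omega> - \<alpha> t *\<^sub>R gradient (fi t (idx t \<omega>)) (x t \<omega>)"
    and "\<And>t. \<alpha> t \<in> {0..alpha_bar c (m t) (L t)}"
    and "\<And>t. G t \<ge> 0"
    and "\<And>t. (G t)\<^sup>2 = (1 / real n) * (\<Sum>i = 1..n. (norm (gradient (fi t i) (xs t)))\<^sup>2)"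
    and "U 0 = (norm (x0 - xs 0))\<^sup>2"
    and "\<And>t. U (Suc t) =
           (INF (\<rho>, l1, l2, l3) \<in> feasible_set (\<alpha> t) (m t) (X_tilde c (m t) (L t)).
              \<rho>\<^sup>2 * U t + l2 * (\<sigma> t)\<^sup>2 + 2 * l3 * (G t)\<^sup>2)"
  shows "\<forall>t. U (Suc t) =
    (sqrt (rho_hat (\<alpha> t) (m t) (X_tilde c (m t) (L t)) * U t + 2 * (\<alpha> t)\<^sup>2 * (G t)\<^sup>2) + \<sigma> t)\<^sup>2"
proof -
  \<comment> \<open>The closed form at time \<open>t\<close> requires \<open>0 \<le> U t\<close>. It
    is itself a square, so non-negativity passes to \<open>U (Suc t)\<close> and the induction below
    removes the condition.\<close>
  have step: "U (Suc t) = (sqrt (rho_hat (\<alpha> t) (m t) (X_tilde c (m t) (L t)) * U t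
      + 2 * (\<alpha> t)\<^sup>2 * (G t)\<^sup>2) + \<sigma> t)\<^sup>2" if "0 \<le> U t" for t
    unfolding assms(20)
    using assms(16)[of t]
    by (intro INF_feasible_cost X_tilde_entries square_le_m_tilde step_size_mult_X_tilde_le
        assms(2-4) that) auto
  have "0 \<le> U t" for t
    by (induction t) (use assms(19) step in auto)
  then show ?thesis using step by blast
qed

end
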